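(* An outerplanar graph $G$ is cop-win if and only if $G$ is connected and chordal.
   Context: A graph is chordal if it has no induced cycle of length greater than $3$. A graph is cop-win if a single cop has a strategy guaranteeing capture of the robber in the game of Cops and Robbers: the cop first chooses a vertex, then the robber chooses a vertex; in each round the cop moves to an adjacent vertex or stays, then the robber does likewise; perfect information; capture occurs when the cop occupies the robber's vertex. *)

theory Defs
  imports "HOL-Analysis.Analysis" "Graph_Theory.Graph_Theory"
begin

text \<open>
  A finite simple graph is a \<^const>\<open>pair_graph\<close>: an undirected edge between \<open>u\<close> and \<open>v\<close> is
  the pair of arcs \<open>(u, v)\<close> and \<open>(v, u)\<close>.
\<close>

abbreviation connected_graph :: "'a pair_pre_digraph \<Rightarrow> bool" where
  "connected_graph G \<equiv> Digraph_Component.connected (with_proj G)"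

text \<open>
  A cycle is given by its list \<open>p\<close> of arcs in one direction of traversal, so its edges are the
  arcs of \<open>p\<close> up to reversal and its length is the length of \<open>p\<close>.  A degenerate back-and-forth
  cycle \<open>[(u, v), (v, u)]\<close> has length 2 and is irrelevant for chordality.
\<close>

definition induced_cycle :: "'a pair_pre_digraph \<Rightarrow> ('a \<times> 'a) list \<Rightarrow> bool" where
  "induced_cycle G p \<longleftrightarrow> pre_digraph.cycle (with_proj G) p \<and>
     (\<forall>u \<in> fst ` set p. \<forall>v \<in> fst ` set p.
        (u, v) \<in> parcs G \<longrightarrow> (u, v) \<in> set p \<or> (v, u) \<in> set p)"

definition chordal :: "'a pair_pre_digraph \<Rightarrow> bool" where
  "chordal G \<longleftrightarrow> \<not> (\<exists>p. induced_cycle G p \<and> length p > 3)"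

text \<open>
  Plane drawings: \<open>\<pi>\<close> places the vertices and \<open>\<gamma> {u, v}\<close> is the arc representing the
  edge between \<open>u\<close> and \<open>v\<close>.
\<close>

definition plane_drawing ::
    "'a pair_pre_digraph \<Rightarrow> ('a \<Rightarrow> complex) \<Rightarrow> ('a set \<Rightarrow> real \<Rightarrow> complex) \<Rightarrow> bool" where
  "plane_drawing G \<pi> \<gamma> \<longleftrightarrow>
     inj_on \<pi> (pverts G) \<and>
     (\<forall>(u, v) \<in> parcs G.
        arc (\<gamma> {u, v}) \<and>
        {pathstart (\<gamma> {u, v}), pathfinish (\<gamma> {u, v})} = {\<pi> u, \<pi> v} \<and>
        path_image (\<gamma> {u, v}) \<inter> \<pi> ` pverts G = {\<pi> u, \<pi> v}) \<and>
     (\<forall>(u, v) \<in> parcs G. \<forall>(x, y) \<in> parcs G. {u, v} \<noteq> {x, y} \<longrightarrow>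
        path_image (\<gamma> {u, v}) \<inter> path_image (\<gamma> {x, y}) = \<pi> ` ({u, v} \<inter> {x, y}))"

definition drawing_image ::
    "'a pair_pre_digraph \<Rightarrow> ('a \<Rightarrow> complex) \<Rightarrow> ('a set \<Rightarrow> real \<Rightarrow> complex) \<Rightarrow> complex set" where
  "drawing_image G \<pi> \<gamma> = \<pi> ` pverts G \<union> (\<Union>(u, v) \<in> parcs G. path_image (\<gamma> {u, v}))"

text \<open>
  For a finite graph the image of a drawing is compact, so \<^const>\<open>outside\<close> of it is its unique
  unbounded face.
\<close>

definition outerplanar :: "'a pair_pre_digraph \<Rightarrow> bool" where
  "outerplanar G \<longleftrightarrow>
     (\<exists>\<pi> \<gamma>. plane_drawing G \<pi> \<gamma> \<and> \<pi> ` pverts G \<subseteq> frontier (outside (drawing_image G \<pi> \<gamma>)))"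

text \<open>
  Cops and Robbers with one cop.  The positions are chosen in the order
  \<open>c 0, r 0, c 1, r 1, \<dots>\<close>.  A strategy of the cop maps the list of all previous positions of the
  robber to the next position of the cop; the previous positions of the cop are determined by
  that list and the strategy.  Plays are continued indefinitely after a capture, which does not
  affect whether a capture occurs.
\<close>

definition legal_move :: "'a pair_pre_digraph \<Rightarrow> 'a \<Rightarrow> 'a \<Rightarrow> bool" where
  "legal_move G u v \<longleftrightarrow> u = v \<or> (u, v) \<in> parcs G"

definition robber_play :: "'a pair_pre_digraph \<Rightarrow> (nat \<Rightarrow> 'a) \<Rightarrow> bool" where
  "robber_play G r \<longleftrightarrow> r 0 \<in> pverts G \<and> (\<forall>n. legal_move G (r n) (r (Suc n)))"

definition cop_play :: "('a list \<Rightarrow> 'a) \<Rightarrow> (nat \<Rightarrow> 'a) \<Rightarrow> nat \<Rightarrow> 'a" where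
  "cop_play \<sigma> r n = \<sigma> (map r [0..<n])"

definition cop_strategy :: "'a pair_pre_digraph \<Rightarrow> ('a list \<Rightarrow> 'a) \<Rightarrow> bool" where
  "cop_strategy G \<sigma> \<longleftrightarrow> \<sigma> [] \<in> pverts G \<and>
     (\<forall>r. robber_play G r \<longrightarrow> (\<forall>n. legal_move G (cop_play \<sigma> r n) (cop_play \<sigma> r (Suc n))))"

text \<open>
  The two disjuncts are capture by a move (or the initial choice) of the robber and capture by
  a move of the cop.
\<close>

definition captured :: "(nat \<Rightarrow> 'a) \<Rightarrow> (nat \<Rightarrow> 'a) \<Rightarrow> bool" where
  "captured c r \<longleftrightarrow> (\<exists>n. c n = r n \<or> c (Suc n) = r n)"

definition cop_win :: "'a pair_pre_digraph \<Rightarrow> bool" where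
  "cop_win G \<longleftrightarrow>
     (\<exists>\<sigma>. cop_strategy G \<sigma> \<and> (\<forall>r. robber_play G r \<longrightarrow> captured (cop_play \<sigma> r) r))"

end

theory Submission
  imports Defs "HOL-Complex_Analysis.Complex_Analysis"
begin

text \<open>
  If \<open>G\<close> is connected and chordal, take a maximal connected vertex set \<open>A\<close> whose closed neighbourhood
  is not everything.  By maximality every vertex of the boundary \<open>N A - A\<close> is adjacent to all
  vertices at distance at least 2 from \<open>A\<close>, and by chordality the boundary is a clique.  So a vertex
  far from \<open>A\<close> is dominated by any boundary vertex; the cop wins after deleting it by induction,
  hence wins in \<open>G\<close> by chasing the image of the robber under the retraction.

  Conversely, let \<open>C\<close> be an induced cycle of length at least 4 in an outerplanar graph.  If a
  component of \<open>G - C\<close> were attached to two nonadjacent vertices of \<open>C\<close>, there would be three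
  internally disjoint paths between them, each with an inner vertex.  One of three arcs that form a
  theta curve lies inside the other two, so its inner vertex is not on the outer face.  Hence
  each component can be retracted to \<open>C\<close>, and the robber stays on \<open>C\<close> away from the image of the cop.
\<close>

subsection \<open>Theta curves\<close>

text \<open>Makes two arcs with common ends accessible to the Jordan curve theorem; reversing
  \<open>h\<close> turns the winding number of the loop into a difference, so the arcs can be
  compared pairwise.\<close>

lemma arc_pair_loop:
  fixes g h :: "real \<Rightarrow> complex"
  assumes "arc g" "arc h" "pathstart g = a" "pathfinish g = b" "pathstart h = a" "pathfinish h = b"
    and "path_image g \<inter> path_image h = {a, b}"
  defines "c \<equiv> g +++ reversepath h"
  shows "simple_path c" "pathfinish c = pathstart c" "path_image c = path_image g \<union> path_image h"
    and "\<And>z. z \<notin> path_image g \<union> path_image h \<Longrightarrow>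
      winding_number c z = winding_number g z - winding_number h z"
proof -
  show "simple_path c"
    unfolding c_def using assms by (intro simple_path_join_loop) (auto simp: arc_reversepath)
  show "pathfinish c = pathstart c" "path_image c = path_image g \<union> path_image h"
    unfolding c_def using assms by (auto simp: path_image_join)
  show "winding_number c z = winding_number g z - winding_number h z"
    if "z \<notin> path_image g \<union> path_image h" for z
    unfolding c_def using assms that
    by (simp add: winding_number_join winding_number_reversepath arc_imp_path)
qed

text \<open>
  Let \<open>W\<^sub>i\<close> be the winding number of \<open>g\<^sub>i\<close>.  If \<open>g\<^sub>3\<close> avoids \<open>I = inside (g\<^sub>1 \<union> g\<^sub>2)\<close>, then
  \<open>W\<^sub>1 \<noteq> W\<^sub>2\<close> on \<open>I\<close>, so there \<open>W\<^sub>3\<close> differs from one of them, say from \<open>W\<^sub>2\<close>; then \<open>I\<close> lies inside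
  \<open>g\<^sub>2 \<union> g\<^sub>3\<close>, and so does the open arc \<open>g\<^sub>1\<close>, which is on the frontier of \<open>I\<close>.
\<close>

lemma theta_curve_inside_aux:
  fixes g1 g2 g3 :: "real \<Rightarrow> complex"
  assumes "arc g1" "pathstart g1 = a" "pathfinish g1 = b"
    and "arc g2" "pathstart g2 = a" "pathfinish g2 = b"
    and "arc g3" "pathstart g3 = a" "pathfinish g3 = b"
    and "path_image g1 \<inter> path_image g2 = {a, b}"
    and "path_image g2 \<inter> path_image g3 = {a, b}"
    and "path_image g1 \<inter> path_image g3 = {a, b}"
    and avoid: "path_image g3 \<inter> inside (path_image g1 \<union> path_image g2) = {}"
    and z: "z \<in> inside (path_image g1 \<union> path_image g2)"
    and W: "winding_number g2 z \<noteq> winding_number g3 z"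
  shows "path_image g1 - {a, b} \<subseteq> inside (path_image g2 \<union> path_image g3)"
proof -
  note L12 = arc_pair_loop[of g1 g2 a b] and L23 = arc_pair_loop[of g2 g3 a b]
  define I where "I = inside (path_image g1 \<union> path_image g2)"
  define J where "J = inside (path_image g2 \<union> path_image g3)"
  define K where "K = outside (path_image g2 \<union> path_image g3)"
  have I: "Topological_Spaces.connected I" "frontier I = path_image g1 \<union> path_image g2"
    using Jordan_inside_outside[OF L12(1,2)] L12(3) assms by (auto simp: I_def)
  have J: "open J" "open K" "J \<inter> K = {}" "J \<union> K = - (path_image g2 \<union> path_image g3)"
      "frontier J = path_image g2 \<union> path_image g3"
    using Jordan_inside_outside[OF L23(1,2)] L23(3) assms by (auto simp: J_def K_def)
  have disj: "I \<inter> (path_image g1 \<union> path_image g2 \<union> path_image g3) = {}"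
    using avoid inside_no_overlap[of "path_image g1 \<union> path_image g2"] unfolding I_def by blast
  have zI: "z \<in> I" using z by (simp add: I_def)
  \<comment> \<open>On \<open>K\<close> the loop has winding number 0, which would give
    \<open>g2\<close> and \<open>g3\<close> equal winding numbers, against \<open>W\<close>.\<close>
  have "z \<notin> K"
  proof
    assume "z \<in> K"
    then have "winding_number (g2 +++ reversepath g3) z = 0"
      using L23 assms by (intro winding_number_zero_in_outside) (auto simp: K_def simple_path_imp_path)
    moreover have "z \<notin> path_image g2 \<union> path_image g3" using zI disj by auto
    ultimately show False using L23(4) assms by auto
  qed
  then have "z \<in> J" using J(4) zI disj by auto
  have "I \<subseteq> J"
  proof (rule ccontr)
    assume "\<not> I \<subseteq> J"
    then have "K \<inter> I \<noteq> {}" using J(4) disj by blast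
    moreover have "J \<inter> I \<noteq> {}" using \<open>z \<in> J\<close> zI by auto
    ultimately show False
      using connectedD[OF I(1) J(1,2)] J(3,4) disj by blast
  qed
  \<comment> \<open>The open arc \<open>g1\<close> lies in \<open>frontier I\<close>, hence in the
    closure of \<open>J\<close>, and it avoids \<open>frontier J\<close> because it meets the other
    two arcs only in \<open>a\<close> and \<open>b\<close>.\<close>
  then have "closure I \<subseteq> closure J" by (rule closure_mono)
  then have "frontier I \<subseteq> J \<union> frontier J"
    using closure_Un_frontier[of I] closure_Un_frontier[of J] by auto
  then show ?thesis
    using I(2) J(5) assms by (auto simp: J_def)
qed

text \<open>If \<open>g3\<close> meets the inside of the loop of \<open>g1\<close> and
  \<open>g2\<close>, its open arc is connected and avoids the loop, so it lies inside entirely.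
  Otherwise winding numbers decide between the first two alternatives.\<close>

lemma theta_curve_inside:
  fixes g1 g2 g3 :: "real \<Rightarrow> complex"
  assumes "arc g1" "pathstart g1 = a" "pathfinish g1 = b"
    and "arc g2" "pathstart g2 = a" "pathfinish g2 = b"
    and "arc g3" "pathstart g3 = a" "pathfinish g3 = b"
    and "path_image g1 \<inter> path_image g2 = {a, b}"
    and "path_image g2 \<inter> path_image g3 = {a, b}"
    and "path_image g1 \<inter> path_image g3 = {a, b}"
  shows "path_image g1 - {a, b} \<subseteq> inside (path_image g2 \<union> path_image g3) \<or>
    path_image g2 - {a, b} \<subseteq> inside (path_image g1 \<union> path_image g3) \<or>
    path_image g3 - {a, b} \<subseteq> inside (path_image g1 \<union> path_image g2)"
proof -
  note L12 = arc_pair_loop[of g1 g2 a b]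
  let ?I = "inside (path_image g1 \<union> path_image g2)" and ?O = "outside (path_image g1 \<union> path_image g2)"
  have J: "?I \<noteq> {}" "open ?I" "open ?O" "?I \<inter> ?O = {}" "?I \<union> ?O = - (path_image g1 \<union> path_image g2)"
    using Jordan_inside_outside[OF L12(1,2)] L12(3) assms by auto
  show ?thesis
  proof (cases "path_image g3 \<inter> ?I = {}")
    case True
    obtain z where z: "z \<in> ?I" using J(1) by auto
    \<comment> \<open>Norm 1 inside the loop means that the winding numbers of \<open>g1\<close> and
      \<open>g2\<close> differ, so that of \<open>g3\<close> cannot equal both.\<close>
    have "norm (winding_number (g1 +++ reversepath g2) z) = 1"
      using L12 assms z by (intro simple_closed_path_norm_winding_number_inside) auto
    moreover have "z \<notin> path_image g1 \<union> path_image g2" using z J(5) by blast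
    ultimately have "winding_number g1 z \<noteq> winding_number g2 z" using L12(4) assms by auto
    then consider "winding_number g2 z \<noteq> winding_number g3 z" | "winding_number g1 z \<noteq> winding_number g3 z"
      by metis
    then show ?thesis
    proof cases
      case 1
      then show ?thesis using theta_curve_inside_aux[of g1 a b g2 g3 z] assms True z by auto
    next
      case 2
      then show ?thesis using theta_curve_inside_aux[of g2 a b g1 g3 z] assms True z
        by (auto simp: Un_commute Int_commute)
    qed
  next
    case False
    have "Topological_Spaces.connected (path_image g3 - {a, b})"
      using connected_simple_path_endless[of g3] assms by (simp add: arc_imp_simple_path)
    moreover have "path_image g3 - {a, b} \<subseteq> ?I \<union> ?O" using J(5) assms by auto
    moreover have "{a, b} \<inter> ?I = {}"
      using inside_no_overlap[of "path_image g1 \<union> path_image g2"] assms(10) by blast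
    then have "?I \<inter> (path_image g3 - {a, b}) \<noteq> {}"
      using False by blast
    ultimately have "?O \<inter> (path_image g3 - {a, b}) = {}"
      using connectedD[of "path_image g3 - {a, b}" ?I ?O] J by auto
    then show ?thesis using \<open>path_image g3 - {a, b} \<subseteq> ?I \<union> ?O\<close> by blast
  qed
qed

text \<open>\<open>outside D\<close> is contained in \<open>outside S\<close>, hence disjoint from
  the open set \<open>inside S\<close>, so no point of the latter is a limit of the former.\<close>

lemma frontier_outside_not_inside:
  assumes "S \<subseteq> D" "closed S" "x \<in> frontier (outside D)"
  shows "x \<notin> inside (S :: complex set)"
proof
  assume x: "x \<in> inside S"
  have "open (inside S)" using assms(2) by (rule open_inside)
  moreover have "x \<in> closure (outside D)" using assms(3) by (simp add: frontier_def)
  ultimately have "inside S \<inter> outside D \<noteq> {}"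
    using x by (meson closure_iff_nhds_not_empty disjoint_iff subset_refl)
  then show False using outside_mono[OF assms(1)] inside_Int_outside[of S] by blast
qed

lemma theta_curve_outer_points:
  fixes g1 g2 g3 :: "real \<Rightarrow> complex"
  assumes g: "arc g1" "pathstart g1 = a" "pathfinish g1 = b"
      "arc g2" "pathstart g2 = a" "pathfinish g2 = b"
      "arc g3" "pathstart g3 = a" "pathfinish g3 = b"
      "path_image g1 \<inter> path_image g2 = {a, b}"
      "path_image g2 \<inter> path_image g3 = {a, b}"
      "path_image g1 \<inter> path_image g3 = {a, b}"
    and D: "path_image g1 \<union> path_image g2 \<union> path_image g3 \<subseteq> D"
    and p: "p1 \<in> path_image g1 - {a, b}" "p2 \<in> path_image g2 - {a, b}" "p3 \<in> path_image g3 - {a, b}"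
  shows "\<not> {p1, p2, p3} \<subseteq> frontier (outside D)"
proof
  assume "{p1, p2, p3} \<subseteq> frontier (outside D)"
  moreover have "closed (path_image g1 \<union> path_image g2)" "closed (path_image g1 \<union> path_image g3)"
      "closed (path_image g2 \<union> path_image g3)"
    using g by (auto intro!: closed_Un closed_path_image simp: arc_imp_path)
  ultimately have "p1 \<notin> inside (path_image g2 \<union> path_image g3)"
      "p2 \<notin> inside (path_image g1 \<union> path_image g3)" "p3 \<notin> inside (path_image g1 \<union> path_image g2)"
    using D frontier_outside_not_inside[of _ D] by (metis Un_subset_iff insert_subset)+
  then show False using theta_curve_inside[OF g] p by blast
qed

subsection \<open>Paths in plane drawings\<close>

abbreviation graph_path :: "'a pair_pre_digraph \<Rightarrow> 'a list \<Rightarrow> bool" where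
  "graph_path G xs \<equiv> distinct xs \<and> successively (\<lambda>u v. (u, v) \<in> parcs G) xs"

abbreviation path_arcs :: "'a list \<Rightarrow> ('a \<times> 'a) set" where
  "path_arcs xs \<equiv> set (zip xs (tl xs))"

lemma path_arcs_in_set:
  assumes "(u, v) \<in> path_arcs xs"
  shows "u \<in> set xs" "v \<in> set xs"
  using assms by (auto dest: set_zip_leftD set_zip_rightD intro: list.set_sel(2))

lemma path_arcs_subset:
  "successively P xs \<Longrightarrow> (u, v) \<in> path_arcs xs \<Longrightarrow> P u v"
  by (induction xs rule: induct_list012) auto

lemma ex_path_arc:
  "x \<in> set xs \<Longrightarrow> length xs \<ge> 2 \<Longrightarrow> \<exists>(u, v) \<in> path_arcs xs. x = u \<or> x = v"
proof (induction xs rule: induct_list012)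
  case (3 y z zs)
  then show ?case by (cases zs) auto
qed auto

text \<open>The first and last entries of a distinct list are consecutive only in length two. This
  later excludes that a path with an inner vertex uses an edge between its ends.\<close>

lemma path_arc_endpoints:
  assumes "distinct xs" "(u, v) \<in> path_arcs xs" "{u, v} = {hd xs, last xs}"
  shows "set xs = {hd xs, last xs}"
proof -
  obtain i where i: "Suc i < length xs" "u = xs ! i" "v = xs ! Suc i"
    using assms(2) by (auto simp: in_set_zip nth_tl less_diff_conv)
  have ne: "xs \<noteq> []" using i by auto
  have "(i = 0 \<and> Suc i = length xs - 1) \<or> (i = length xs - 1 \<and> Suc i = 0)"
    using assms(1,3) i ne
    by (auto simp: doubleton_eq_iff hd_conv_nth last_conv_nth nth_eq_iff_index_eq)
  then have "length xs = 2" using i by auto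
  then obtain x y where "xs = [x, y]"
    by (metis (no_types, opaque_lifting) One_nat_def Suc_1 length_0_conv length_Suc_conv)
  then show ?thesis by auto
qed

locale drawn_graph =
  fixes G :: "'a pair_pre_digraph" and \<pi> :: "'a \<Rightarrow> complex" and \<gamma> :: "'a set \<Rightarrow> real \<Rightarrow> complex"
  assumes drawing: "plane_drawing G \<pi> \<gamma>"
begin

text \<open>\<open>\<gamma>\<close> is indexed by the unordered edge and fixes no direction, so the
  arc may have to be reversed.\<close>

lemma edge_arc:
  assumes "(u, v) \<in> parcs G"
  obtains g where "arc g" "pathstart g = \<pi> u" "pathfinish g = \<pi> v" "path_image g = path_image (\<gamma> {u, v})"
proof -
  have "arc (\<gamma> {u, v})" "{pathstart (\<gamma> {u, v}), pathfinish (\<gamma> {u, v})} = {\<pi> u, \<pi> v}"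
    using drawing assms by (auto simp: plane_drawing_def)
  then show ?thesis
    using that[of "\<gamma> {u, v}"] that[of "reversepath (\<gamma> {u, v})"]
    by (auto simp: doubleton_eq_iff arc_reversepath)
qed

lemma edges_Int:
  assumes "(u, v) \<in> parcs G" "(x, y) \<in> parcs G" "{u, v} \<noteq> {x, y}"
  shows "path_image (\<gamma> {u, v}) \<inter> path_image (\<gamma> {x, y}) = \<pi> ` ({u, v} \<inter> {x, y})"
  using drawing assms unfolding plane_drawing_def by blast

lemma edge_ends_in_image:
  assumes "(u, v) \<in> parcs G"
  shows "\<pi> u \<in> path_image (\<gamma> {u, v})" "\<pi> v \<in> path_image (\<gamma> {u, v})"
  using edge_arc[OF assms] pathstart_in_path_image pathfinish_in_path_image by metis+

definition path_drawing :: "'a list \<Rightarrow> complex set" where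
  "path_drawing xs = (\<Union>(u, v) \<in> path_arcs xs. path_image (\<gamma> {u, v}))"

text \<open>Induction on the path: since \<open>x\<close> does not occur again, the first edge meets
  the remaining ones only in \<open>\<pi> y\<close>, so joining it keeps an arc.\<close>

lemma path_drawing_arc:
  assumes "graph_path G xs" "length xs \<ge> 2"
  shows "\<exists>g. arc g \<and> pathstart g = \<pi> (hd xs) \<and> pathfinish g = \<pi> (last xs) \<and>
    path_image g = path_drawing xs"
  using assms
proof (induction xs rule: induct_list012)
  case (3 x y zs)
  have xy: "(x, y) \<in> parcs G" using 3 by auto
  obtain e where e: "arc e" "pathstart e = \<pi> x" "pathfinish e = \<pi> y" "path_image e = path_image (\<gamma> {x, y})"
    using edge_arc[OF xy] .
  show ?case
  proof (cases zs)
    case Nil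
    then show ?thesis using e by (auto simp: path_drawing_def)
  next
    case (Cons z zs')
    then obtain g where g: "arc g" "pathstart g = \<pi> y" "pathfinish g = \<pi> (last (y # zs))"
        "path_image g = path_drawing (y # zs)"
      using 3 by auto
    have "path_image e \<inter> path_image g \<subseteq> {\<pi> y}"
    proof
      fix p assume "p \<in> path_image e \<inter> path_image g"
      then obtain u v where uv: "(u, v) \<in> path_arcs (y # zs)" "p \<in> path_image (\<gamma> {u, v})"
          "p \<in> path_image (\<gamma> {x, y})"
        using e g by (auto simp: path_drawing_def)
      have "(u, v) \<in> parcs G"
        using path_arcs_subset[OF _ uv(1), of "\<lambda>u v. (u, v) \<in> parcs G"] 3 by simp
      moreover have x: "x \<noteq> u" "x \<noteq> v" using path_arcs_in_set[OF uv(1)] 3 by auto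
      moreover from x have "{x, y} \<noteq> {u, v}" by (auto simp: doubleton_eq_iff)
      ultimately have "p \<in> \<pi> ` ({x, y} \<inter> {u, v})" using edges_Int[OF xy] uv by blast
      then show "p \<in> {\<pi> y}" using x by auto
    qed
    then have "arc (e +++ g)" using e g by (intro arc_join) auto
    moreover have "path_image (e +++ g) = path_drawing (x # y # zs)"
      using e g by (auto simp: path_image_join path_drawing_def)
    ultimately show ?thesis using e g by (intro exI[of _ "e +++ g"]) auto
  qed
qed auto

lemma vertex_in_path_drawing:
  assumes "graph_path G xs" "length xs \<ge> 2" "x \<in> set xs"
  shows "\<pi> x \<in> path_drawing xs"
proof -
  obtain u v where "(u, v) \<in> path_arcs xs" "x = u \<or> x = v" using ex_path_arc[OF assms(3,2)] by auto
  then show ?thesis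
    using path_arcs_subset[of _ xs u v] assms(1) edge_ends_in_image by (force simp: path_drawing_def)
qed

lemma path_drawing_subset: "graph_path G xs \<Longrightarrow> path_drawing xs \<subseteq> drawing_image G \<pi> \<gamma>"
  using path_arcs_subset[of _ xs] unfolding path_drawing_def drawing_image_def by blast

text \<open>Distinct edges meet only in images of common vertices, so the danger is an edge shared
  by both paths. Its ends would be \<open>a\<close> and \<open>b\<close>, making \<open>xs\<close>
  that edge alone, against \<open>set xs \<noteq> {a, b}\<close>.\<close>

lemma path_drawings_Int:
  assumes xs: "graph_path G xs" "hd xs = a" "last xs = b" "set xs \<noteq> {a, b}" "length xs \<ge> 2"
    and ys: "graph_path G ys" "length ys \<ge> 2"
    and Int: "set xs \<inter> set ys = {a, b}"
  shows "path_drawing xs \<inter> path_drawing ys = {\<pi> a, \<pi> b}"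
proof
  show "{\<pi> a, \<pi> b} \<subseteq> path_drawing xs \<inter> path_drawing ys"
    using vertex_in_path_drawing[of xs] vertex_in_path_drawing[of ys] assms by blast
  show "path_drawing xs \<inter> path_drawing ys \<subseteq> {\<pi> a, \<pi> b}"
  proof
    fix p assume "p \<in> path_drawing xs \<inter> path_drawing ys"
    then obtain u v w t where uv: "(u, v) \<in> path_arcs xs" "p \<in> path_image (\<gamma> {u, v})"
        and wt: "(w, t) \<in> path_arcs ys" "p \<in> path_image (\<gamma> {w, t})"
      by (auto simp: path_drawing_def)
    have arcs: "(u, v) \<in> parcs G" "(w, t) \<in> parcs G"
      using path_arcs_subset[OF _ uv(1)] path_arcs_subset[OF _ wt(1)] xs ys by auto
    have sub: "{u, v} \<inter> {w, t} \<subseteq> {a, b}"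
      using path_arcs_in_set[OF uv(1)] path_arcs_in_set[OF wt(1)] Int by blast
    have "{u, v} \<noteq> {w, t}"
    proof
      assume "{u, v} = {w, t}"
      then have "{u, v} \<subseteq> {a, b}" using sub by auto
      moreover have "u \<noteq> v"
        using edge_arc[OF arcs(1)] arc_distinct_ends by metis
      ultimately have "{u, v} = {hd xs, last xs}" using xs by auto
      then show False using path_arc_endpoints[OF _ uv(1)] xs by auto
    qed
    then show "p \<in> {\<pi> a, \<pi> b}" using edges_Int[OF arcs] uv wt sub by blast
  qed
qed

end

text \<open>The inner vertices \<open>p\<close>, \<open>q\<close>, \<open>r\<close> give points on
  the three open arcs of a theta curve, and outerplanarity would put all of them on the frontier of
  the outer face.\<close>

lemma outerplanar_no_theta:
  assumes "outerplanar G"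
    and P: "graph_path G xs" "hd xs = a" "last xs = b" "p \<in> set xs - {a, b}"
    and Q: "graph_path G ys" "hd ys = a" "last ys = b" "q \<in> set ys - {a, b}"
    and R: "graph_path G zs" "hd zs = a" "last zs = b" "r \<in> set zs - {a, b}"
    and Int: "set xs \<inter> set ys = {a, b}" "set ys \<inter> set zs = {a, b}" "set xs \<inter> set zs = {a, b}"
    and V: "{a, b, p, q, r} \<subseteq> pverts G"
  shows False
proof -
  obtain \<pi> \<gamma> where d: "plane_drawing G \<pi> \<gamma>"
    and outer: "\<pi> ` pverts G \<subseteq> frontier (outside (drawing_image G \<pi> \<gamma>))"
    using assms(1) by (auto simp: outerplanar_def)
  interpret drawn_graph G \<pi> \<gamma> by unfold_locales (rule d)
  have inj: "inj_on \<pi> (pverts G)" using d by (auto simp: plane_drawing_def)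
  have len: "length ws \<ge> 2" if "hd ws = a" "x \<in> set ws - {a, b}" for ws x
    using that by (cases ws; cases "tl ws") auto
  note lens = len[OF P(2,4)] len[OF Q(2,4)] len[OF R(2,4)]
  obtain g1 where g1: "arc g1" "pathstart g1 = \<pi> a" "pathfinish g1 = \<pi> b" "path_image g1 = path_drawing xs"
    using path_drawing_arc[OF P(1) lens(1)] P by auto
  obtain g2 where g2: "arc g2" "pathstart g2 = \<pi> a" "pathfinish g2 = \<pi> b" "path_image g2 = path_drawing ys"
    using path_drawing_arc[OF Q(1) lens(2)] Q by auto
  obtain g3 where g3: "arc g3" "pathstart g3 = \<pi> a" "pathfinish g3 = \<pi> b" "path_image g3 = path_drawing zs"
    using path_drawing_arc[OF R(1) lens(3)] R by auto
  have "path_image g1 \<inter> path_image g2 = {\<pi> a, \<pi> b}" "path_image g1 \<inter> path_image g3 = {\<pi> a, \<pi> b}"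
      "path_image g2 \<inter> path_image g3 = {\<pi> a, \<pi> b}"
    unfolding g1(4) g2(4) g3(4) by (rule path_drawings_Int; use P Q R lens Int in blast)+
  moreover have "path_image g1 \<union> path_image g2 \<union> path_image g3 \<subseteq> drawing_image G \<pi> \<gamma>"
    using g1 g2 g3 P Q R by (simp add: path_drawing_subset)
  moreover have "\<pi> p \<in> path_image g1 - {\<pi> a, \<pi> b}" "\<pi> q \<in> path_image g2 - {\<pi> a, \<pi> b}"
      "\<pi> r \<in> path_image g3 - {\<pi> a, \<pi> b}"
    using vertex_in_path_drawing P Q R lens g1 g2 g3 inj V by (auto simp: inj_on_eq_iff)
  moreover have "{\<pi> p, \<pi> q, \<pi> r} \<subseteq> frontier (outside (drawing_image G \<pi> \<gamma>))"
    using outer V by auto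
  ultimately show False
    using theta_curve_outer_points[of g1 "\<pi> a" "\<pi> b" g2 g3 "drawing_image G \<pi> \<gamma>" "\<pi> p" "\<pi> q" "\<pi> r"] g1 g2 g3
    by blast
qed

subsection \<open>Dominated vertices in chordal graphs\<close>

text \<open>An induced cycle of length at least 4, indexed by its vertices; the equivalence states
  both the edges and the absence of chords.\<close>

definition hole :: "'a rel \<Rightarrow> nat \<Rightarrow> (nat \<Rightarrow> 'a) \<Rightarrow> bool" where
  "hole E n c \<longleftrightarrow> n \<ge> 4 \<and> inj_on c {..<n} \<and>
    (\<forall>i<n. \<forall>j<n. (c i, c j) \<in> E \<longleftrightarrow>
      j = Suc i \<or> i = Suc j \<or> i = 0 \<and> j = n - 1 \<or> j = 0 \<and> i = n - 1)"

section \<open>Shortest walks and connected vertex sets\<close>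

lemma rtrancl_walk:
  assumes "(x, y) \<in> R\<^sup>*"
  shows "\<exists>xs. xs \<noteq> [] \<and> hd xs = x \<and> last xs = y \<and> successively (\<lambda>u v. (u, v) \<in> R) xs"
  using assms
proof induction
  case base
  show ?case by (rule exI[of _ "[x]"]) auto
next
  case (step y z)
  then obtain xs where "xs \<noteq> []" "hd xs = x" "last xs = y" "successively (\<lambda>u v. (u, v) \<in> R) xs"
    by blast
  then show ?case using step by (intro exI[of _ "xs @ [z]"]) (auto simp: successively_append_iff)
qed

text \<open>In a walk of least length, a repeated vertex or a forward chord would allow a
  shortcut.\<close>

lemma rtrancl_shortest_walk:
  assumes "(x, y) \<in> R\<^sup>*"
  obtains xs where "xs \<noteq> []" "hd xs = x" "last xs = y" "successively (\<lambda>u v. (u, v) \<in> R) xs"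
    "distinct xs" "\<And>i j. i < j \<Longrightarrow> j < length xs \<Longrightarrow> (xs ! i, xs ! j) \<in> R \<Longrightarrow> j = Suc i"
proof -
  define W where "W xs \<longleftrightarrow> xs \<noteq> [] \<and> hd xs = x \<and> last xs = y \<and> successively (\<lambda>u v. (u, v) \<in> R) xs" for xs
  obtain xs where xs: "W xs" and least: "\<And>ys. W ys \<Longrightarrow> length xs \<le> length ys"
    using rtrancl_walk[OF assms] ex_has_least_nat[of W _ length] unfolding W_def by metis
  have split: "successively (\<lambda>u v. (u, v) \<in> R) (take i xs)" "successively (\<lambda>u v. (u, v) \<in> R) (drop i xs)" for i
    using xs successively_append_iff[of _ "take i xs" "drop i xs"] by (auto simp: W_def)
  have last_take: "last (take (Suc i) xs) = xs ! i" if "i < length xs" for i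
    using that by (simp add: take_Suc_conv_app_nth)
  have splice: "W (take (Suc i) xs @ drop j xs)"
    if "i < length xs" "j < length xs" "(xs ! i, xs ! j) \<in> R" for i j
  proof -
    have "take (Suc i) xs \<noteq> []" "hd (take (Suc i) xs) = hd xs" "drop j xs \<noteq> []"
      using that xs by (auto simp: W_def)
    then show ?thesis
      using that xs split(1)[of "Suc i"] split(2)[of j] last_take[of i] unfolding W_def
      by (simp add: successively_append_iff hd_drop_conv_nth)
  qed
  have chord: "j = Suc i" if "i < j" "j < length xs" "(xs ! i, xs ! j) \<in> R" for i j
  proof -
    from least[OF splice, of i j] show ?thesis using that by auto
  qed
  have "xs ! i \<noteq> xs ! j" if "i < j" "j < length xs" for i j
  proof
    assume eq: "xs ! i = xs ! j"
    \<comment> \<open>The closed part between \<open>i\<close> and \<open>j\<close> is cut out. For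
      \<open>i = 0\<close> the walk starts at position \<open>j\<close> instead; otherwise the step
      into position \<open>i\<close> is also a step to position \<open>j\<close>.\<close>
    have "W (take i xs @ drop j xs)"
    proof (cases i)
      case 0
      then show ?thesis using that xs split eq unfolding W_def
        by (auto simp: hd_drop_conv_nth hd_conv_nth)
    next
      case (Suc k)
      have "(xs ! k, xs ! Suc k) \<in> R"
        using xs that Suc by (auto simp: W_def successively_conv_nth)
      then show ?thesis using splice[of k j] that eq Suc by simp
    qed
    from least[OF this] show False using that by auto
  qed
  then have "distinct xs" by (metis distinct_conv_nth linorder_neqE_nat)
  with xs chord show ?thesis using that by (auto simp: W_def)
qed

lemma walk_in_restriction:
  assumes "successively (\<lambda>u v. (u, v) \<in> E \<inter> B \<times> B) xs" "xs \<noteq> []" "hd xs \<in> B"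
  shows "set xs \<subseteq> B"
  using assms by (induction xs rule: induct_list012) auto

definition connected_in :: "'a rel \<Rightarrow> 'a set \<Rightarrow> bool" where
  "connected_in E X \<longleftrightarrow> (\<forall>x \<in> X. \<forall>y \<in> X. (x, y) \<in> (E \<inter> X \<times> X)\<^sup>*)"

lemma connected_in_insert:
  assumes "sym E" "connected_in E A" "a \<in> A" "(a, s) \<in> E"
  shows "connected_in E (insert s A)"
proof -
  let ?R = "E \<inter> insert s A \<times> insert s A"
  have "(x, a) \<in> ?R\<^sup>*" "(a, x) \<in> ?R\<^sup>*" if "x \<in> insert s A" for x
  proof -
    have mono: "(E \<inter> A \<times> A)\<^sup>* \<subseteq> ?R\<^sup>*" by (rule rtrancl_mono) auto
    have "(a, s) \<in> ?R" "(s, a) \<in> ?R" using assms by (auto dest: symD)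
    then show "(x, a) \<in> ?R\<^sup>*" "(a, x) \<in> ?R\<^sup>*"
      using that assms(2,3) mono by (auto simp: connected_in_def)
  qed
  then show ?thesis unfolding connected_in_def by (meson rtrancl_trans)
qed

text \<open>A shortest walk from \<open>s\<close> to \<open>t\<close> through \<open>A\<close> is
  chordless and has at least three vertices. On it \<open>r\<close> is adjacent to the two ends
  only, so \<open>r\<close> closes it to a hole.\<close>

lemma hole_through_nonadjacent:
  assumes "sym E" "irrefl E" and A: "connected_in E A"
    and s: "s \<notin> A" "a \<in> A" "(a, s) \<in> E" and t: "t \<notin> A" "b \<in> A" "(b, t) \<in> E"
    and st: "s \<noteq> t" "(s, t) \<notin> E"
    and r: "r \<notin> A" "(s, r) \<in> E" "(t, r) \<in> E" "\<And>a. a \<in> A \<Longrightarrow> (a, r) \<notin> E"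
  shows "\<exists>n c. hole E n c \<and> c ` {..<n} \<subseteq> insert r (insert s (insert t A))"
proof -
  define B where "B = insert s (insert t A)"
  have "connected_in E B"
    unfolding B_def
    using connected_in_insert[OF assms(1) connected_in_insert[OF assms(1) A t(2,3)], of a s] s by auto
  then have "(s, t) \<in> (E \<inter> B \<times> B)\<^sup>*" by (auto simp: connected_in_def B_def)
  then obtain xs where xs: "xs \<noteq> []" "hd xs = s" "last xs = t"
      "successively (\<lambda>u v. (u, v) \<in> E \<inter> B \<times> B) xs" "distinct xs"
      and chord: "\<And>i j. i < j \<Longrightarrow> j < length xs \<Longrightarrow> (xs ! i, xs ! j) \<in> E \<inter> B \<times> B \<Longrightarrow> j = Suc i"
    by (rule rtrancl_shortest_walk) blast
  define m where "m = length xs"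
  have xsB: "set xs \<subseteq> B" using walk_in_restriction[OF xs(4,1)] xs(2) by (auto simp: B_def)
  have xs_nth: "xs ! i \<in> B" if "i < m" for i using that xsB by (auto simp: m_def)
  have succ: "(xs ! i, xs ! Suc i) \<in> E" if "Suc i < m" for i
    using xs(4) that by (auto simp: successively_conv_nth m_def)
  have ends: "xs ! 0 = s" "xs ! (m - 1) = t" using xs by (auto simp: hd_conv_nth last_conv_nth m_def)
  have "m \<noteq> 0" "m \<noteq> 1" using xs(1) ends st by (auto simp: m_def)
  moreover have "m \<noteq> 2" using succ[of 0] ends st by auto
  ultimately have m: "m \<ge> 3" by auto
  have rB: "r \<notin> B" using r st assms(2) by (auto simp: B_def irrefl_def)
  have symE: "(x, y) \<in> E \<longleftrightarrow> (y, x) \<in> E" for x y using assms(1) by (auto dest: symD)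
  have adj: "(xs ! i, xs ! j) \<in> E \<longleftrightarrow> j = Suc i \<or> i = Suc j" if "i < m" "j < m" for i j
  proof -
    have "xs ! i \<in> B" "xs ! j \<in> B" using that xsB by (auto simp: m_def)
    then show ?thesis
      using chord[of i j] chord[of j i] succ[of i] succ[of j] that symE[of "xs ! i" "xs ! j"] assms(2)
      by (cases i j rule: linorder_cases) (auto simp: m_def irrefl_def)
  qed
  have adj_r: "(xs ! i, r) \<in> E \<longleftrightarrow> i = 0 \<or> i = m - 1" if "i < m" for i
  proof -
    have "xs ! i \<noteq> s" if "i \<noteq> 0" using that \<open>i < m\<close> ends(1) xs(5) m
      by (metis m_def nth_eq_iff_index_eq less_nat_zero_code neq0_conv)
    moreover have "xs ! i \<noteq> t" if "i \<noteq> m - 1" using that \<open>i < m\<close> ends(2) xs(5) m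
      nth_eq_iff_index_eq[of xs i "m - 1"] by (auto simp: m_def)
    moreover have "xs ! i \<in> B" using that xsB by (auto simp: m_def)
    ultimately show ?thesis using r ends unfolding B_def by blast
  qed
  \<comment> \<open>\<open>r\<close> gets the last index \<open>m\<close>, so its neighbours have
    the indices \<open>m - 1\<close> and 0.\<close>
  define c where "c i = (if i < m then xs ! i else r)" for i
  have "inj_on c {..<Suc m}"
    using xs(5) rB xsB by (auto simp: inj_on_def c_def nth_eq_iff_index_eq m_def less_Suc_eq dest: nth_mem)
  moreover have "(c i, c j) \<in> E \<longleftrightarrow> j = Suc i \<or> i = Suc j \<or> i = 0 \<and> j = Suc m - 1 \<or> j = 0 \<and> i = Suc m - 1"
    if ij: "i < Suc m" "j < Suc m" for i j
  proof -
    consider "i < m" "j < m" | "i < m" "j = m" | "i = m" "j < m" | "i = m" "j = m"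
      using ij by (auto simp: less_Suc_eq)
    then show ?thesis
    proof cases
      case 1 then show ?thesis using adj[of i j] by (auto simp: c_def)
    next
      case 2 then show ?thesis using adj_r[of i] m by (auto simp: c_def)
    next
      case 3 then show ?thesis using adj_r[of j] symE[of r "xs ! j"] m by (auto simp: c_def)
    next
      case 4 then show ?thesis using assms(2) m by (auto simp: c_def irrefl_def)
    qed
  qed
  ultimately have "hole E (Suc m) c" using m unfolding hole_def by auto
  moreover have "c ` {..<Suc m} \<subseteq> insert r B" using xs_nth by (auto simp: c_def)
  ultimately show ?thesis unfolding B_def by blast
qed

text \<open>In a complete \<open>X\<close> any two vertices serve. Otherwise \<open>u\<close> is a
  vertex \<open>r\<close> beyond the closed neighbourhood of a maximal \<open>A\<close>, and
  \<open>v\<close> is any boundary vertex \<open>s\<close>.\<close>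

lemma chordal_dominated_vertex:
  assumes "sym E" "irrefl E" and X: "finite X" "card X \<ge> 2" and conn: "connected_in E X"
    and nohole: "\<And>n c. hole E n c \<Longrightarrow> \<not> c ` {..<n} \<subseteq> X"
  obtains u v where "u \<in> X" "v \<in> X" "u \<noteq> v" "(v, u) \<in> E"
    "\<And>x. x \<in> X \<Longrightarrow> (u, x) \<in> E \<Longrightarrow> x = v \<or> (v, x) \<in> E"
proof (cases "\<forall>x \<in> X. \<forall>y \<in> X. x \<noteq> y \<longrightarrow> (x, y) \<in> E")
  case True
  obtain u v where "u \<in> X" "v \<in> X" "u \<noteq> v" using X by (metis card_le_Suc0_iff_eq not_less_eq_eq numeral_2_eq_2)
  with True show ?thesis by (intro that[of u v]) auto
next
  case False
  then obtain x y where xy: "x \<in> X" "y \<in> X" "x \<noteq> y" "(x, y) \<notin> E" by blast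
  \<comment> \<open>\<open>N A\<close> may contain vertices of \<open>A\<close>, so the boundary is
    \<open>N A - A\<close>.\<close>
  define N where "N A = {s \<in> X. \<exists>a \<in> A. (a, s) \<in> E}" for A
  define F where "F = {A. A \<subseteq> X \<and> A \<noteq> {} \<and> connected_in E A \<and> X - A - N A \<noteq> {}}"
  \<comment> \<open>\<open>y\<close> lies outside the closed neighbourhood of
    \<open>x\<close>.\<close>
  have "{x} \<in> F" using xy by (auto simp: F_def N_def connected_in_def)
  moreover have "finite F" using X(1) by (rule_tac finite_subset[of _ "Pow X"]) (auto simp: F_def)
  ultimately obtain A where AF: "A \<in> F" and max: "\<And>B. B \<in> F \<Longrightarrow> A \<subseteq> B \<Longrightarrow> A = B"
    using finite_has_maximal[of F] by auto
  have A: "A \<subseteq> X" "A \<noteq> {}" "connected_in E A" using AF by (auto simp: F_def)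
  obtain r where r: "r \<in> X" "r \<notin> A" "r \<notin> N A" using AF by (auto simp: F_def)
  \<comment> \<open>By maximality, the closed neighbourhood of the connected set
    \<open>insert s A\<close> is all of \<open>X\<close>, so \<open>z\<close> can only be reached
    through \<open>s\<close>.\<close>
  have complete: "(s, z) \<in> E" if "s \<in> N A" "s \<notin> A" "z \<in> X" "z \<notin> A" "z \<notin> N A" for s z
  proof -
    have "connected_in E (insert s A)" using connected_in_insert[OF assms(1) A(3)] that(1) by (auto simp: N_def)
    moreover have "insert s A \<notin> F" using max[of "insert s A"] that by blast
    ultimately have "z \<in> insert s A \<or> z \<in> N (insert s A)"
      using A that by (auto simp: F_def N_def)
    then show ?thesis using that by (auto simp: N_def)
  qed
  \<comment> \<open>With an empty boundary, \<open>A\<close> would be closed under adjacency in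
    \<open>X\<close>, and connectedness would put \<open>r\<close> into \<open>A\<close>.\<close>
  have "\<exists>s. s \<in> N A \<and> s \<notin> A"
  proof (rule ccontr)
    assume no: "\<not> ?thesis"
    obtain a where a: "a \<in> A" using A by auto
    then have "(a, r) \<in> (E \<inter> X \<times> X)\<^sup>*" using conn A r by (auto simp: connected_in_def)
    then have "r \<in> A" using a no by induction (auto simp: N_def)
    then show False using r by simp
  qed
  then obtain s where s: "s \<in> N A" "s \<notin> A" by blast
  have clique: "(s, t) \<in> E" if t: "t \<in> N A" "t \<notin> A" "t \<noteq> s" for t
  proof (rule ccontr)
    assume "(s, t) \<notin> E"
    moreover obtain a b where "a \<in> A" "(a, s) \<in> E" "b \<in> A" "(b, t) \<in> E" using s t by (auto simp: N_def)
    moreover have "(s, r) \<in> E" "(t, r) \<in> E" using complete s t r by auto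
    ultimately obtain n c where "hole E n c" "c ` {..<n} \<subseteq> insert r (insert s (insert t A))"
      using hole_through_nonadjacent[OF assms(1,2) A(3), of s a t b r] s t r by (auto simp: N_def)
    moreover have "insert r (insert s (insert t A)) \<subseteq> X" using s t r A by (auto simp: N_def)
    ultimately show False using nohole by blast
  qed
  have sr: "(s, r) \<in> E" using complete s r by auto
  show ?thesis
  proof (rule that[of r s])
    show "s \<in> X" using s by (auto simp: N_def)
    show "r \<noteq> s" using sr assms(2) by (auto simp: irrefl_def)
    \<comment> \<open>A neighbour of \<open>r\<close> is not in \<open>A\<close>, so it is either on
      the boundary, covered by \<open>clique\<close>, or beyond it, covered by
      \<open>complete\<close>.\<close>
    show "z = s \<or> (s, z) \<in> E" if z: "z \<in> X" "(r, z) \<in> E" for z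
    proof -
      have "z \<notin> A" using r z assms(1) by (auto simp: N_def dest: symD)
      then show ?thesis using complete[OF s, of z] clique[of z] z by blast
    qed
  qed (use r sr in auto)
qed

section \<open>The game with a bounded number of moves\<close>

text \<open>The cop is to move and \<open>n\<close> bounds its remaining moves. If the robber steps
  onto the cop, the capture is counted on the next turn, when the cop stays.\<close>

primrec cop_wins_within :: "'a set \<Rightarrow> 'a rel \<Rightarrow> nat \<Rightarrow> 'a \<Rightarrow> 'a \<Rightarrow> bool" where
  "cop_wins_within X E 0 c r \<longleftrightarrow> False"
| "cop_wins_within X E (Suc n) c r \<longleftrightarrow> (\<exists>c' \<in> X. (c, c') \<in> E\<^sup>= \<and>
     (c' = r \<or> (\<forall>r' \<in> X. (r, r') \<in> E\<^sup>= \<longrightarrow> cop_wins_within X E n c' r')))"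

text \<open>The cop plays in \<open>X - {u}\<close> against the image of the robber under the
  retraction sending \<open>u\<close> to \<open>v\<close>. The extra move is for catching the robber
  after its image.\<close>

lemma cop_wins_within_add_dominated:
  assumes "sym E" and uv: "u \<in> X" "v \<in> X" "u \<noteq> v" "(v, u) \<in> E"
    and dom: "\<And>x. x \<in> X \<Longrightarrow> (u, x) \<in> E \<Longrightarrow> x = v \<or> (v, x) \<in> E"
    and "cop_wins_within (X - {u}) E n c (if r = u then v else r)" "r \<in> X"
  shows "cop_wins_within X E (Suc n) c r"
  using assms(7,8)
proof (induction n arbitrary: c r)
  case (Suc n)
  let ?f = "\<lambda>x. if x = u then v else x"
  from Suc.prems(1) obtain c' where c': "c' \<in> X - {u}" "(c, c') \<in> E\<^sup>="
    and next_move: "c' = ?f r \<or> (\<forall>r' \<in> X - {u}. (?f r, r') \<in> E\<^sup>= \<longrightarrow> cop_wins_within (X - {u}) E n c' r')"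
    unfolding cop_wins_within.simps by blast
  show ?case
  proof (cases "c' = r")
    case True
    then show ?thesis using c' by auto
  next
    case False
    have "cop_wins_within X E (Suc n) c' r'" if r': "r' \<in> X" "(r, r') \<in> E\<^sup>=" for r'
    proof (cases "c' = ?f r")
      case True
      \<comment> \<open>The image is caught at \<open>v\<close> while the robber is at
        \<open>u\<close>; as \<open>v\<close> dominates \<open>u\<close>, every reply ends in the
        closed neighbourhood of the cop.\<close>
      with False have "r = u" "c' = v" by (auto split: if_splits)
      then have "(c', r') \<in> E\<^sup>=" using r' dom uv by auto
      then show ?thesis using r' by auto
    next
      case False
      have "(?f r, ?f r') \<in> E\<^sup>="
        using r' dom[of r'] dom[of r] Suc.prems(2) uv \<open>sym E\<close> by (auto dest: symD)
      moreover have "?f r' \<in> X - {u}" using r' uv by auto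
      ultimately have "cop_wins_within (X - {u}) E n c' (?f r')" using False next_move by blast
      then show ?thesis using Suc.IH r'(1) by blast
    qed
    then show ?thesis using c' by (subst cop_wins_within.simps) blast
  qed
qed auto

text \<open>The retraction sending \<open>u\<close> to \<open>v\<close> turns walks in
  \<open>X\<close> into walks that avoid \<open>u\<close>.\<close>

lemma connected_in_remove_dominated:
  assumes "sym E" and uv: "u \<in> X" "v \<in> X" "u \<noteq> v" "(v, u) \<in> E"
    and dom: "\<And>x. x \<in> X \<Longrightarrow> (u, x) \<in> E \<Longrightarrow> x = v \<or> (v, x) \<in> E"
    and conn: "connected_in E X"
  shows "connected_in E (X - {u})"
  unfolding connected_in_def
proof (intro ballI)
  fix x y assume x: "x \<in> X - {u}" and y: "y \<in> X - {u}"
  let ?f = "\<lambda>x. if x = u then v else x" and ?R = "E \<inter> (X - {u}) \<times> (X - {u})"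
  have "(x, y) \<in> (E \<inter> X \<times> X)\<^sup>*" using conn x y by (auto simp: connected_in_def)
  then have "(x, ?f y) \<in> ?R\<^sup>*"
  proof induction
    case base
    then show ?case using x by auto
  next
    case (step y z)
    then have "(?f y, ?f z) \<in> ?R\<^sup>="
      using uv dom[of y] dom[of z] \<open>sym E\<close> by (auto dest: symD)
    then show ?case using step.IH by (auto intro: rtrancl_into_rtrancl)
  qed
  then show "(x, y) \<in> ?R\<^sup>*" using y by simp
qed

text \<open>Dominated vertices are deleted down to a single vertex. Deletion preserves connectedness
  and creates no holes; putting a vertex back costs one cop move.\<close>

lemma chordal_cop_wins_within:
  assumes "sym E" "irrefl E" "finite X" "X \<noteq> {}" "connected_in E X"
    and "\<And>n c. hole E n c \<Longrightarrow> \<not> c ` {..<n} \<subseteq> X"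
  shows "\<exists>c \<in> X. \<exists>n. \<forall>r \<in> X. cop_wins_within X E n c r"
  using assms(3-)
proof (induction "card X" arbitrary: X rule: less_induct)
  case less
  show ?case
  proof (cases "card X \<ge> 2")
    case False
    moreover have "card X > 0" using less.prems by (simp add: card_gt_0_iff)
    ultimately have "card X = 1" by linarith
    then obtain x where "X = {x}" by (auto simp: card_1_singleton_iff)
    then show ?thesis by (auto intro!: exI[of _ "Suc 0"])
  next
    case True
    obtain u v where uv: "u \<in> X" "v \<in> X" "u \<noteq> v" "(v, u) \<in> E"
      and dom: "\<And>x. x \<in> X \<Longrightarrow> (u, x) \<in> E \<Longrightarrow> x = v \<or> (v, x) \<in> E"
      using chordal_dominated_vertex[OF assms(1,2) less.prems(1) True less.prems(3,4)] by metis
    have "card (X - {u}) < card X" using uv less.prems(1) by (intro card_Diff1_less)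
    moreover have "connected_in E (X - {u})"
      using connected_in_remove_dominated[OF assms(1) uv dom less.prems(3)] .
    moreover have "X - {u} \<noteq> {}" using uv by auto
    ultimately obtain c n where c: "c \<in> X - {u}" "\<And>r. r \<in> X - {u} \<Longrightarrow> cop_wins_within (X - {u}) E n c r"
      using less.hyps[of "X - {u}"] less.prems(1,4) by (metis Diff_subset finite_Diff subset_trans)
    have "cop_wins_within X E (Suc n) c r" if "r \<in> X" for r
      using cop_wins_within_add_dominated[OF assms(1) uv dom _ that, of n c] c(2) uv that by auto
    then show ?thesis using c(1) by blast
  qed
qed

subsection \<open>Strategies\<close>

text \<open>\<open>S c r\<close> is a safety invariant of the robber for positions with the cop to
  move.\<close>

lemma not_cop_win_if_evasion:
  assumes G: "pair_graph G"
    and start: "\<And>c. c \<in> pverts G \<Longrightarrow> \<exists>r \<in> pverts G. S c r"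
    and step: "\<And>c c' r. \<lbrakk>S c r; c \<in> pverts G; r \<in> pverts G; legal_move G c c'\<rbrakk> \<Longrightarrow>
      c' \<noteq> r \<and> (\<exists>r'. legal_move G r r' \<and> S c' r')"
  shows "\<not> cop_win G"
proof
  assume "cop_win G"
  then obtain \<sigma> where \<sigma>: "cop_strategy G \<sigma>" "\<And>r. robber_play G r \<Longrightarrow> captured (cop_play \<sigma> r) r"
    by (auto simp: cop_win_def)
  interpret pair_graph G by (rule G)
  have legal_verts: "v \<in> pverts G" if "legal_move G u v" "u \<in> pverts G" for u v
    using that by (auto simp: legal_move_def dest: in_arcsD2)
  \<comment> \<open>The robber stays when it has no good move, so that its play is legal unconditionally.\<close>
  define answer where "answer c r =
    (if \<exists>r'. legal_move G r r' \<and> S c r' then SOME r'. legal_move G r r' \<and> S c r' else r)" for c r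
  have answer: "legal_move G r (answer c r)" for c r
  proof (cases "\<exists>r'. legal_move G r r' \<and> S c r'")
    case True
    then show ?thesis using someI_ex[OF True] by (simp add: answer_def)
  next
    case False
    then have "answer c r = r" unfolding answer_def by (rule if_not_P)
    then show ?thesis by (simp add: legal_move_def)
  qed
  have answer_safe: "S c (answer c r)" if "\<exists>r'. legal_move G r r' \<and> S c r'" for c r
    using that someI_ex[OF that] by (simp add: answer_def)
  obtain r0 where r0: "r0 \<in> pverts G" "S (\<sigma> []) r0"
    using start[of "\<sigma> []"] \<sigma>(1) by (auto simp: cop_strategy_def)
  \<comment> \<open>\<open>hist n\<close> lists \<open>r 0\<close> to \<open>r n\<close>. A strategy
    sees only robber positions, so \<open>\<sigma> (hist n)\<close> is the next position of the cop,
    and the play is built by recursion on this list.\<close>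
  define hist where "hist = rec_nat [r0] (\<lambda>_ h. h @ [answer (\<sigma> h) (last h)])"
  define r where "r n = last (hist n)" for n
  have hist: "hist 0 = [r0]" "hist (Suc n) = hist n @ [answer (\<sigma> (hist n)) (last (hist n))]" for n
    by (auto simp: hist_def)
  have hist_r: "hist n = map r [0..<Suc n]" for n
    by (induction n) (auto simp: hist r_def)
  have r_0: "r 0 = r0" by (simp add: r_def hist)
  have r_Suc: "r (Suc n) = answer (cop_play \<sigma> r (Suc n)) (r n)" for n
  proof -
    have "r (Suc n) = answer (\<sigma> (hist n)) (r n)" by (simp add: r_def hist(2))
    then show ?thesis by (simp only: cop_play_def hist_r)
  qed
  have play: "robber_play G r"
    unfolding robber_play_def using r_0 r0 r_Suc answer by auto
  then have cop: "legal_move G (cop_play \<sigma> r n) (cop_play \<sigma> r (Suc n))" for n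
    using \<sigma>(1) by (auto simp: cop_strategy_def)
  have inv: "S (cop_play \<sigma> r n) (r n) \<and> cop_play \<sigma> r n \<in> pverts G \<and> r n \<in> pverts G" for n
  proof (induction n)
    case 0
    then show ?case using r0 r_0 \<sigma>(1) by (auto simp: cop_play_def cop_strategy_def)
  next
    case (Suc n)
    then have "\<exists>r'. legal_move G (r n) r' \<and> S (cop_play \<sigma> r (Suc n)) r'" using step cop by blast
    then show ?case
      using Suc cop[of n] answer_safe answer legal_verts unfolding r_Suc by metis
  qed
  \<comment> \<open>Applying \<open>step\<close> to a staying cop gives the first
    inequality.\<close>
  have "cop_play \<sigma> r n \<noteq> r n" "cop_play \<sigma> r (Suc n) \<noteq> r n" for n
    using step[of "cop_play \<sigma> r n" "r n"] inv[of n] cop[of n] by (auto simp: legal_move_def)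
  then show False using \<sigma>(2)[OF play] by (auto simp: captured_def)
qed

text \<open>The cop plays positionally, always lowering the least number of moves within which it
  can win.\<close>

lemma cop_win_if_cop_wins_within:
  assumes G: "pair_graph G" and c0: "c0 \<in> pverts G"
    and win: "\<And>r. r \<in> pverts G \<Longrightarrow> cop_wins_within (pverts G) (parcs G) n0 c0 r"
  shows "cop_win G"
proof -
  interpret pair_graph G by (rule G)
  let ?W = "cop_wins_within (pverts G) (parcs G)"
  have legal_iff: "(u, v) \<in> (parcs G)\<^sup>= \<longleftrightarrow> legal_move G u v" for u v by (auto simp: legal_move_def)
  have legal_verts: "v \<in> pverts G" if "legal_move G u v" "u \<in> pverts G" for u v
    using that by (auto simp: legal_move_def dest: in_arcsD2)
  \<comment> \<open>The least bound makes the choice depend on the two positions only, so that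
    \<open>foldl\<close> can iterate it.\<close>
  define good where "good c r c' \<longleftrightarrow> legal_move G c c' \<and>
    (c' = r \<or> (\<forall>r'. legal_move G r r' \<longrightarrow> ?W ((LEAST n. ?W n c r) - 1) c' r'))" for c r c'
  have ex_good: "\<exists>c'. good c r c'" if "?W n c r" "r \<in> pverts G" for n c r
  proof -
    let ?m = "LEAST n. ?W n c r"
    have W: "?W ?m c r" using that(1) by (rule LeastI)
    then obtain k where k: "?m = Suc k" by (cases ?m) auto
    obtain c' where "legal_move G c c'" "c' = r \<or> (\<forall>r' \<in> pverts G. legal_move G r r' \<longrightarrow> ?W k c' r')"
      using W unfolding k cop_wins_within.simps legal_iff by blast
    then have "good c r c'"
      using legal_verts that(2) unfolding good_def k by auto
    then show ?thesis by blast
  qed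
  \<comment> \<open>Staying by default keeps the strategy legal in positions without a known
    bound.\<close>
  define move where "move c r = (if \<exists>c'. good c r c' then SOME c'. good c r c' else c)" for c r
  have move_legal: "legal_move G c (move c r)" for c r
  proof (cases "\<exists>c'. good c r c'")
    case True
    then have "good c r (move c r)" using someI_ex[OF True] by (simp add: move_def)
    then show ?thesis by (simp add: good_def)
  next
    case False
    then show ?thesis by (simp add: move_def legal_move_def)
  qed
  have move_good: "good c r (move c r)" if "?W n c r" "r \<in> pverts G" for n c r
    using ex_good[OF that] someI_ex[OF ex_good[OF that]] by (simp add: move_def)
  define \<sigma> where "\<sigma> = foldl move c0"
  have play_Suc: "cop_play \<sigma> r (Suc n) = move (cop_play \<sigma> r n) (r n)" for r n
    by (simp add: cop_play_def \<sigma>_def)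
  have "cop_strategy G \<sigma>"
    using c0 move_legal unfolding cop_strategy_def play_Suc by (simp add: \<sigma>_def)
  moreover have "captured (cop_play \<sigma> r) r" if r: "robber_play G r" for r
  proof -
    have rV: "r n \<in> pverts G" for n
      using r by (induction n) (auto simp: robber_play_def intro: legal_verts)
    \<comment> \<open>The induction is strong since the bound becomes \<open>?m - 1\<close>, which
      may be smaller than \<open>m - 1\<close>.\<close>
    have "?W m (cop_play \<sigma> r k) (r k) \<Longrightarrow> captured (cop_play \<sigma> r) r" for m k
    proof (induction m arbitrary: k rule: less_induct)
      case (less m)
      let ?c = "cop_play \<sigma> r k"
      let ?m = "LEAST n. ?W n ?c (r k)"
      have m: "?m \<le> m" "?W ?m ?c (r k)" using less.prems by (auto intro: Least_le LeastI)
      then have "?m \<noteq> 0" by (metis cop_wins_within.simps(1))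
      have "good ?c (r k) (cop_play \<sigma> r (Suc k))"
        unfolding play_Suc using move_good[OF less.prems rV] .
      then consider "cop_play \<sigma> r (Suc k) = r k" | "?W (?m - 1) (cop_play \<sigma> r (Suc k)) (r (Suc k))"
        using r by (auto simp: good_def robber_play_def)
      then show ?case
      proof cases
        case 1
        then show ?thesis by (auto simp: captured_def)
      next
        case 2
        then show ?thesis using less.IH[of "?m - 1" "Suc k"] m \<open>?m \<noteq> 0\<close> by linarith
      qed
    qed
    moreover have "?W n0 (cop_play \<sigma> r 0) (r 0)" using win[OF rV] by (simp add: cop_play_def \<sigma>_def)
    ultimately show ?thesis by blast
  qed
  ultimately show ?thesis unfolding cop_win_def by blast
qed

subsection \<open>Cycles and connectedness\<close>

lemma pcas_iff:
  "pcas u p v \<longleftrightarrow> (if p = [] then u = v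
     else fst (hd p) = u \<and> snd (last p) = v \<and> successively (\<lambda>e f. snd e = fst f) p)"
proof (induction p arbitrary: u)
  case (Cons e p)
  show ?case
  proof (cases p)
    case (Cons f q)
    then show ?thesis using Cons.IH[of "snd e"]
      by (simp del: pcas.simps(2) add: pcas.simps(2)[of _ e] eq_commute[of "snd e"]) metis
  qed auto
qed auto

lemma pawalk_verts_eq: "pcas u p v \<Longrightarrow> pawalk_verts u p = u # map snd p"
  by (induction p arbitrary: u) auto

lemma cycle_with_proj_iff:
  "pre_digraph.cycle (with_proj G) p \<longleftrightarrow> p \<noteq> [] \<and> fst (hd p) = snd (last p) \<and>
     successively (\<lambda>e f. snd e = fst f) p \<and> distinct (map snd p) \<and> set p \<subseteq> parcs G \<and>
     fst (hd p) \<in> pverts G"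
  unfolding pre_digraph.cycle_def pre_digraph.awalk_def cas_with_proj_eq awalk_verts_with_proj_eq
  by (auto simp: pcas_iff pawalk_verts_eq)

text \<open>Translates between cycles as lists of arcs in one direction and indexed vertices;
  symmetry of the arcs supplies the opposite direction.\<close>

lemma chordal_iff_no_hole:
  assumes "pair_graph G"
  shows "chordal G \<longleftrightarrow> \<not> (\<exists>n c. hole (parcs G) n c)"
proof -
  interpret pair_graph G by fact
  have sym: "(u, v) \<in> parcs G \<longleftrightarrow> (v, u) \<in> parcs G" for u v
    using pair_sym_arcs by (auto simp: symmetric_def dest: symD)
  have "\<exists>n c. hole (parcs G) n c" if p: "induced_cycle G p" "length p > 3" for p
  proof -
    define n c where "n = length p" and "c i = snd (p ! i)" for i
    have p': "fst (p ! 0) = snd (p ! (n - 1))" "\<And>i. Suc i < n \<Longrightarrow> snd (p ! i) = fst (p ! Suc i)"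
        "distinct (map snd p)" "set p \<subseteq> parcs G"
      using p by (auto simp: induced_cycle_def cycle_with_proj_iff hd_conv_nth last_conv_nth
          successively_conv_nth n_def)
    have n: "n \<ge> 4" using p by (simp add: n_def)
    have inj: "c i = c j \<longleftrightarrow> i = j" if "i < n" "j < n" for i j
      using p'(3) that nth_eq_iff_index_eq[of "map snd p" i j] by (simp add: c_def n_def)
    have p_Suc: "p ! Suc i = (c i, c (Suc i))" if "Suc i < n" for i
      using p'(2)[OF that] by (simp add: c_def prod_eq_iff)
    \<comment> \<open>As \<open>c i\<close> is the head of arc \<open>i\<close>, the wrap-around
      occurs at arc 0.\<close>
    have p_0: "p ! 0 = (c (n - 1), c 0)"
      using p'(1) by (simp add: c_def prod_eq_iff)
    have in_p: "(c i, c j) \<in> set p \<longleftrightarrow> j = Suc i \<or> j = 0 \<and> i = n - 1" if ij: "i < n" "j < n" for i j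
    proof
      assume "(c i, c j) \<in> set p"
      then obtain k where "k < n" "p ! k = (c i, c j)" by (auto simp: in_set_conv_nth n_def)
      then show "j = Suc i \<or> j = 0 \<and> i = n - 1"
        using p_0 p_Suc ij n by (cases k) (auto simp: inj)
    next
      assume "j = Suc i \<or> j = 0 \<and> i = n - 1"
      moreover have "p ! j \<in> set p" using ij by (simp add: n_def)
      ultimately show "(c i, c j) \<in> set p" using p_0 p_Suc ij by auto
    qed
    have fst_p: "c i \<in> fst ` set p" if "i < n" for i
    proof (cases "Suc i < n")
      case True
      then show ?thesis using p_Suc by (metis fst_conv image_eqI n_def nth_mem)
    next
      case False
      then have "i = n - 1" using that by simp
      moreover have "p ! 0 \<in> set p" using n by (intro nth_mem) (unfold n_def, linarith)
      ultimately show ?thesis using p_0 by (metis fst_conv image_eqI)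
    qed
    have "(c i, c j) \<in> parcs G \<longleftrightarrow> (c i, c j) \<in> set p \<or> (c j, c i) \<in> set p" if "i < n" "j < n" for i j
      using p(1) fst_p[OF that(1)] fst_p[OF that(2)] p'(4) sym[of "c i" "c j"]
      unfolding induced_cycle_def by (metis subsetD)
    then have "hole (parcs G) n c"
      using in_p n inj unfolding hole_def inj_on_def by auto
    then show ?thesis by blast
  qed
  moreover have "\<exists>p. induced_cycle G p \<and> length p > 3" if h: "hole (parcs G) n c" for n c
  proof -
    \<comment> \<open>Here arc \<open>i\<close> leaves \<open>c i\<close>, so the wrap-around occurs
      at the last arc.\<close>
    define p where "p = map (\<lambda>i. (c i, c (if Suc i = n then 0 else Suc i))) [0..<n]"
    have n: "n \<ge> 4" using h by (simp add: hole_def)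
    have adj: "(c i, c j) \<in> parcs G \<longleftrightarrow> j = Suc i \<or> i = Suc j \<or> i = 0 \<and> j = n - 1 \<or> j = 0 \<and> i = n - 1"
      if "i < n" "j < n" for i j
      using h that by (simp add: hole_def)
    have inj: "c i = c j \<longleftrightarrow> i = j" if "i < n" "j < n" for i j
      using h that by (auto simp: hole_def inj_on_def)
    have set_p: "set p \<subseteq> parcs G" using n by (auto simp: p_def adj)
    have nth_p: "p ! i = (c i, c (if Suc i = n then 0 else Suc i))" if "i < n" for i
      using that by (simp add: p_def)
    have len: "length p = n" by (simp add: p_def)
    have "distinct (map snd p)"
      unfolding distinct_conv_nth using len by (auto simp: nth_p inj split: if_splits)
    moreover have "successively (\<lambda>e f. snd e = fst f) p"
      unfolding successively_conv_nth using len by (auto simp: nth_p)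
    moreover have "p \<noteq> []" using n len by auto
    moreover from this have "fst (hd p) = snd (last p)"
      using n len nth_p[of 0] nth_p[of "n - 1"] by (simp add: hd_conv_nth last_conv_nth)
    moreover have "fst (hd p) \<in> pverts G"
      using \<open>p \<noteq> []\<close> set_p arc_fst_in_verts by (metis hd_in_set subsetD)
    ultimately have "pre_digraph.cycle (with_proj G) p" using set_p by (simp add: cycle_with_proj_iff)
    moreover have arcs: "(c i, c (if Suc i = n then 0 else Suc i)) \<in> set p" if "i < n" for i
      using that by (auto simp: p_def)
    have "(c i, c j) \<in> set p \<or> (c j, c i) \<in> set p" if "i < n" "j < n" "(c i, c j) \<in> parcs G" for i j
      using that n arcs[of i] arcs[of j] by (auto simp: adj split: if_splits)
    then have "\<forall>u \<in> fst ` set p. \<forall>v \<in> fst ` set p. (u, v) \<in> parcs G \<longrightarrow> (u, v) \<in> set p \<or> (v, u) \<in> set p"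
      by (auto simp: p_def)
    ultimately show ?thesis using n len unfolding induced_cycle_def by (intro exI[of _ p]) auto
  qed
  ultimately show ?thesis unfolding chordal_def by blast
qed

lemma connected_graph_iff:
  assumes "pair_graph G"
  shows "connected_graph G \<longleftrightarrow> pverts G \<noteq> {} \<and> connected_in (parcs G) (pverts G)"
proof -
  interpret pair_graph G by fact
  have "(parcs G)\<^sup>s = parcs G"
    using pair_sym_arcs by (auto simp: symmetric_def symcl_def dest: symD)
  moreover have "parcs G \<inter> pverts G \<times> pverts G = parcs G"
    by (auto dest: in_arcsD1 in_arcsD2)
  moreover have "(u, v) \<in> rtrancl_on (pverts G) (parcs G) \<longleftrightarrow> (u, v) \<in> (parcs G)\<^sup>*"
    if "u \<in> pverts G" "v \<in> pverts G" for u v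
    using that rtrancl_consistent_rtrancl_on[of u v "parcs G" "pverts G"]
    by (auto dest: rtrancl_on_rtranclI in_arcsD2)
  ultimately show ?thesis
    unfolding connected_conv connected_in_def by simp
qed

text \<open>In a disconnected graph the robber starts in a component without the cop and stays
  put.\<close>

lemma cop_win_connected:
  assumes "pair_graph G" "cop_win G"
  shows "connected_graph G"
proof (rule ccontr)
  interpret pair_graph G by fact
  assume not_conn: "\<not> connected_graph G"
  have sym: "sym ((parcs G)\<^sup>*)" using pair_sym_arcs by (auto simp: symmetric_def sym_rtrancl)
  have "pverts G \<noteq> {}" using assms(2) by (auto simp: cop_win_def cop_strategy_def)
  moreover have "parcs G \<inter> pverts G \<times> pverts G = parcs G"
    by (auto dest: in_arcsD1 in_arcsD2)
  ultimately obtain u v where uv: "u \<in> pverts G" "v \<in> pverts G" "(u, v) \<notin> (parcs G)\<^sup>*"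
    using not_conn connected_graph_iff[OF assms(1)] by (auto simp: connected_in_def)
  have "\<not> cop_win G"
  proof (rule not_cop_win_if_evasion[OF assms(1), where S = "\<lambda>c r. (c, r) \<notin> (parcs G)\<^sup>*"])
    show "\<exists>r \<in> pverts G. (c, r) \<notin> (parcs G)\<^sup>*" for c
      using uv sym by (meson rtrancl_trans symD)
    show "c' \<noteq> r \<and> (\<exists>r'. legal_move G r r' \<and> (c', r') \<notin> (parcs G)\<^sup>*)"
      if "(c, r) \<notin> (parcs G)\<^sup>*" "legal_move G c c'" for c c' r
      using that by (auto simp: legal_move_def intro: converse_rtrancl_into_rtrancl)
  qed
  then show False using assms(2) by simp
qed

subsection \<open>Holes in outerplanar graphs\<close>

lemma hole_in_pverts:
  assumes "pair_graph G" "hole (parcs G) n c" "k < n"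
  shows "c k \<in> pverts G"
proof -
  interpret pair_graph G by fact
  have "(c k, c (if Suc k = n then k - 1 else Suc k)) \<in> parcs G"
    using assms(2,3) by (auto simp: hole_def)
  then show ?thesis by (rule in_arcsD1)
qed

text \<open>The robber is at \<open>c i\<close> and the image of the cop at \<open>c x\<close>. If
  they are adjacent, the robber steps to its other neighbour on the cycle, which is not adjacent to
  \<open>c x\<close> because \<open>n \<ge> 4\<close>.\<close>

lemma hole_escape:
  assumes "hole E n c" "i < n" "x < n" "x \<noteq> i"
  obtains k where "k < n" "k = i \<or> (c i, c k) \<in> E" "k \<noteq> x" "(c x, c k) \<notin> E"
proof -
  have n: "n \<ge> 4" and adj: "\<And>i j. i < n \<Longrightarrow> j < n \<Longrightarrow> (c i, c j) \<in> E \<longleftrightarrow>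
      j = Suc i \<or> i = Suc j \<or> i = 0 \<and> j = n - 1 \<or> j = 0 \<and> i = n - 1"
    using assms(1) by (auto simp: hole_def)
  \<comment> \<open>\<open>s\<close> and \<open>p\<close> are the cyclic successor and
    predecessor.\<close>
  define s where "s i = (if Suc i = n then 0 else Suc i)" for i
  define p where "p i = (if i = 0 then n - 1 else i - 1)" for i
  have "(c x, c i) \<notin> E \<or> x = s i \<or> x = p i"
    using adj[OF assms(3,2)] assms n by (auto simp: s_def p_def split: if_splits)
  then consider "(c x, c i) \<notin> E" | "x = s i" | "x = p i" by blast
  then show ?thesis
  proof cases
    case 1
    then show ?thesis using that[of i] assms by auto
  next
    case 2
    have "p i < n" using assms n by (auto simp: p_def)
    moreover from this have "(c i, c (p i)) \<in> E" "p i \<noteq> x" "(c x, c (p i)) \<notin> E"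
      using 2 assms n by (auto simp: adj s_def p_def split: if_splits)
    ultimately show ?thesis using that by blast
  next
    case 3
    have "s i < n" using assms n by (auto simp: s_def)
    moreover from this have "(c i, c (s i)) \<in> E" "s i \<noteq> x" "(c x, c (s i)) \<notin> E"
      using 3 assms n by (auto simp: adj s_def p_def split: if_splits)
    ultimately show ?thesis using that by blast
  qed
qed

lemma successively_upt:
  "(\<And>k. a \<le> k \<Longrightarrow> Suc k < b \<Longrightarrow> P k (Suc k)) \<Longrightarrow> successively P [a..<b]"
  by (auto simp: successively_conv_nth)

text \<open>For \<open>v\<close> outside \<open>C\<close>, these are the neighbours in
  \<open>C\<close> of the component of \<open>v\<close> in the graph without
  \<open>C\<close>.\<close>

definition attachments :: "'a rel \<Rightarrow> 'a set \<Rightarrow> 'a \<Rightarrow> 'a set" where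
  "attachments E C v = {x \<in> C. \<exists>w. (v, w) \<in> (E \<inter> (- C) \<times> (- C))\<^sup>* \<and> (w, x) \<in> E}"

lemma outerplanar_hole_attachments:
  assumes G: "pair_graph G" "outerplanar G" and h: "hole (parcs G) n c"
    and v: "v \<notin> c ` {..<n}"
    and ij: "i < j" "j < n" "c i \<in> attachments (parcs G) (c ` {..<n}) v"
      "c j \<in> attachments (parcs G) (c ` {..<n}) v"
  shows "(c i, c j) \<in> parcs G"
proof (rule ccontr)
  assume nadj: "(c i, c j) \<notin> parcs G"
  interpret pair_graph G by (rule G)
  define C where "C = c ` {..<n}"
  define R where "R = parcs G \<inter> (- C) \<times> (- C)"
  have sym: "sym (parcs G)" using pair_sym_arcs by (auto simp: symmetric_def)
  have adj: "(c i, c j) \<in> parcs G \<longleftrightarrow> j = Suc i \<or> i = Suc j \<or> i = 0 \<and> j = n - 1 \<or> j = 0 \<and> i = n - 1"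
    if "i < n" "j < n" for i j
    using h that by (simp add: hole_def)
  have inj: "c i = c j \<longleftrightarrow> i = j" if "i < n" "j < n" for i j
    using h that by (auto simp: hole_def inj_on_def)
  have inj_on: "inj_on c A" if "A \<subseteq> {..<n}" for A
    using h that by (auto simp: hole_def intro: inj_on_subset)
  obtain w1 w2 where w: "(v, w1) \<in> R\<^sup>*" "(w1, c i) \<in> parcs G" "(v, w2) \<in> R\<^sup>*" "(w2, c j) \<in> parcs G"
    using ij(3,4) by (auto simp: attachments_def R_def C_def)
  have "sym R" using sym by (auto simp: R_def sym_def)
  then have "(w1, w2) \<in> R\<^sup>*" using w by (meson rtrancl_trans sym_rtrancl symD)
  then obtain ds where ds: "ds \<noteq> []" "hd ds = w1" "last ds = w2"
      "successively (\<lambda>u v. (u, v) \<in> R) ds" "distinct ds"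
    by (rule rtrancl_shortest_walk) blast
  have "w1 \<notin> C" using w(1) v by (induction rule: rtrancl_induct) (auto simp: R_def C_def)
  then have dsC: "set ds \<subseteq> - C"
    using walk_in_restriction[of "parcs G" "- C" ds] ds by (simp add: R_def)
  \<comment> \<open>The theta: \<open>xs\<close> and \<open>ys\<close> are the two ways around the
    hole, \<open>ys\<close> descending from \<open>i\<close> to 0 and then from \<open>n - 1\<close>
    to \<open>j\<close>, and \<open>zs\<close> runs through the component of
    \<open>v\<close>.\<close>
  define xs ys zs where "xs = map c [i..<Suc j]" and "ys = map c (rev [0..<Suc i] @ rev [j..<n])"
    and "zs = c i # ds @ [c j]"
  \<comment> \<open>An inner vertex of \<open>ys\<close>: \<open>c 0\<close>, unless that is the end
    \<open>c i\<close> itself.\<close>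
  define q where "q = (if i = 0 then c (n - 1) else c 0)"
  \<comment> \<open>Nonadjacency gives both ways around the hole an inner vertex.\<close>
  have far: "j \<noteq> Suc i" "i \<noteq> 0 \<or> j \<noteq> n - 1" using nadj adj[of i j] ij by auto
  have "graph_path G xs"
    using ij inj_on[of "set [i..<Suc j]"]
    by (auto simp: xs_def subset_eq distinct_map successively_map adj intro!: successively_upt simp del: upt_Suc)
  moreover have "hd xs = c i" "last xs = c j" using ij by (auto simp: xs_def hd_map last_map)
  moreover have "c (Suc i) \<in> set xs - {c i, c j}" using ij far by (auto simp: xs_def inj)
  moreover have "graph_path G ys"
  proof
    show "distinct ys" using ij unfolding ys_def distinct_map by (auto intro: inj_on simp del: upt_Suc)
    show "successively (\<lambda>u v. (u, v) \<in> parcs G) ys"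
      unfolding ys_def successively_map successively_append_iff successively_rev
      using ij by (auto simp: adj last_rev hd_rev intro!: successively_upt simp del: upt_Suc)
  qed
  moreover have "hd ys = c i" "last ys = c j" using ij by (auto simp: ys_def last_map last_rev)
  moreover have "q \<in> set ys - {c i, c j}" using ij far by (auto simp: ys_def q_def inj)
  moreover have "graph_path G zs"
  proof
    show "distinct zs" using ds(5) dsC ij by (auto simp: zs_def inj C_def)
    have "successively (\<lambda>u v. (u, v) \<in> parcs G) ds"
      using ds(4) by (rule successively_mono) (auto simp: R_def)
    then show "successively (\<lambda>u v. (u, v) \<in> parcs G) zs"
      using ds w sym by (auto simp: zs_def successively_append_iff successively_Cons dest: symD)
  qed
  moreover have "hd zs = c i" "last zs = c j" by (auto simp: zs_def)
  moreover have "w1 \<in> set zs - {c i, c j}" using ds ij \<open>w1 \<notin> C\<close> by (auto simp: zs_def C_def)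
  moreover have "set xs \<inter> set ys = {c i, c j}"
    using ij by (auto simp: xs_def ys_def inj simp del: upt_Suc)
  moreover have "set ys \<inter> set zs = {c i, c j}"
    using ij dsC by (auto simp: ys_def zs_def C_def simp del: upt_Suc)
  moreover have "set xs \<inter> set zs = {c i, c j}"
    using ij dsC by (auto simp: xs_def zs_def C_def simp del: upt_Suc)
  moreover have "{c i, c j, c (Suc i), q, w1} \<subseteq> pverts G"
    using ij w(2) in_arcsD1 hole_in_pverts[OF G(1) h] by (auto simp: q_def)
  ultimately show False using outerplanar_no_theta[OF G(2)] by metis
qed

lemma outerplanar_hole_not_cop_win:
  assumes G: "pair_graph G" "outerplanar G" and h: "hole (parcs G) n c"
  shows "\<not> cop_win G"
proof -
  interpret pair_graph G by (rule G)
  define C where "C = c ` {..<n}"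
  define R where "R = parcs G \<inter> (- C) \<times> (- C)"
  have sym: "sym (parcs G)" using pair_sym_arcs by (auto simp: symmetric_def)
  have n: "n \<ge> 4" using h by (simp add: hole_def)
  have CV: "x \<in> pverts G" if "x \<in> C" for x
    using that hole_in_pverts[OF G(1) h] by (auto simp: C_def)
  have att: "x = y \<or> (x, y) \<in> parcs G"
    if xy: "x \<in> attachments (parcs G) C v" "y \<in> attachments (parcs G) C v" "v \<notin> C" for x y v
  proof -
    obtain i j where ij: "i < n" "x = c i" "j < n" "y = c j" using xy by (auto simp: attachments_def C_def)
    then show ?thesis
      using outerplanar_hole_attachments[OF G h, of v i j] outerplanar_hole_attachments[OF G h, of v j i]
        xy sym by (cases i j rule: linorder_cases) (auto simp: C_def dest: symD)
  qed
  \<comment> \<open>\<open>f\<close> retracts onto \<open>C\<close>. The chosen attachment depends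
    only on the attachment set, hence is constant on components; a component without attachments
    goes to \<open>c 0\<close>.\<close>
  define f where "f v = (if v \<in> C then v else if attachments (parcs G) C v = {} then c 0
    else SOME x. x \<in> attachments (parcs G) C v)" for v
  have f_att: "f v \<in> attachments (parcs G) C v" if "x \<in> attachments (parcs G) C v" "v \<notin> C" for v x
    using that by (auto simp: f_def intro: someI)
  have fC: "f v \<in> C" for v
  proof (cases "v \<notin> C \<and> attachments (parcs G) C v \<noteq> {}")
    case True
    then have "f v \<in> attachments (parcs G) C v" using f_att by blast
    then show ?thesis by (simp add: attachments_def)
  next
    case False
    then show ?thesis using n by (auto simp: f_def C_def)
  qed
  \<comment> \<open>Both \<open>x\<close> and \<open>f u\<close> are attachments of the component of
    \<open>u\<close>, hence equal or adjacent by \<open>att\<close>.\<close>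
  have f_into: "f u = x \<or> (f u, x) \<in> parcs G" if "(u, x) \<in> parcs G" "u \<notin> C" "x \<in> C" for u x
  proof -
    have "x \<in> attachments (parcs G) C u" using that by (auto simp: attachments_def)
    then show ?thesis using att f_att that by blast
  qed
  have f_edge: "f u = f v \<or> (f u, f v) \<in> parcs G" if uv: "(u, v) \<in> parcs G" for u v
  proof (cases "u \<in> C"; cases "v \<in> C")
    assume "u \<notin> C" "v \<notin> C"
    then have "(u, v) \<in> R" "(v, u) \<in> R" using uv sym by (auto simp: R_def dest: symD)
    then have "attachments (parcs G) C u = attachments (parcs G) C v"
      unfolding attachments_def R_def[symmetric] by (auto intro: converse_rtrancl_into_rtrancl)
    then show ?thesis using \<open>u \<notin> C\<close> \<open>v \<notin> C\<close> by (simp add: f_def)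
  next
    assume "u \<in> C" "v \<notin> C"
    then show ?thesis using f_into[of v u] uv sym by (auto simp: f_def[of u] dest: symD)
  next
    assume "u \<notin> C" "v \<in> C"
    then show ?thesis using f_into[of u v] uv by (auto simp: f_def[of v])
  next
    assume "u \<in> C" "v \<in> C"
    then show ?thesis using uv by (simp add: f_def)
  qed
  have escape: "\<exists>r' \<in> C. legal_move G r r' \<and> x \<noteq> r' \<and> (x, r') \<notin> parcs G"
    if rx: "r \<in> C" "x \<in> C" "x \<noteq> r" for r x
  proof -
    obtain i j where ij: "i < n" "r = c i" "j < n" "x = c j" "j \<noteq> i" using rx by (auto simp: C_def)
    then obtain k where "k < n" "k = i \<or> (c i, c k) \<in> parcs G" "k \<noteq> j" "(c j, c k) \<notin> parcs G"
      using hole_escape[OF h, of i j] by metis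
    then show ?thesis using ij h
      by (intro bexI[of _ "c k"]) (auto simp: legal_move_def C_def hole_def inj_on_def)
  qed
  show ?thesis
  proof (rule not_cop_win_if_evasion[OF G(1), where S = "\<lambda>p r. r \<in> C \<and> f p \<noteq> r \<and> (f p, r) \<notin> parcs G"])
    fix p
    \<comment> \<open>The robber first takes any vertex of \<open>C\<close> other than the image of
      the cop; \<open>escape\<close> then provides a safe start.\<close>
    have "c 0 \<noteq> c 1" using h n inj_onD[of c "{..<n}" 0 1] by (auto simp: hole_def)
    moreover have "c 0 \<in> C" "c 1 \<in> C" using n by (auto simp: C_def)
    ultimately obtain r where "r \<in> C" "f p \<noteq> r" by metis
    then show "\<exists>r \<in> pverts G. r \<in> C \<and> f p \<noteq> r \<and> (f p, r) \<notin> parcs G"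
      using escape[of r "f p"] fC CV by blast
  next
    fix p p' r
    assume r: "r \<in> C \<and> f p \<noteq> r \<and> (f p, r) \<notin> parcs G" and "legal_move G p p'"
    \<comment> \<open>The image of the cop moves along an edge or stays, so it cannot reach the
      nonadjacent \<open>r\<close>; as \<open>f\<close> fixes \<open>r\<close>, neither does the
      cop.\<close>
    then have "f p' \<noteq> r" using f_edge[of p p'] by (auto simp: legal_move_def)
    moreover have "f r = r" using r by (simp add: f_def)
    ultimately show "p' \<noteq> r \<and> (\<exists>r'. legal_move G r r' \<and> r' \<in> C \<and> f p' \<noteq> r' \<and> (f p', r') \<notin> parcs G)"
      using escape[of r "f p'"] r fC by blast
  qed
qed

section \<open>The two directions of the equivalence\<close>

lemma connected_chordal_cop_win:
  assumes "pair_graph G" "connected_graph G" "chordal G"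
  shows "cop_win G"
proof -
  interpret pair_graph G by fact
  have "sym (parcs G)" "irrefl (parcs G)"
    using pair_sym_arcs by (auto simp: symmetric_def irrefl_def dest: pair_no_loops)
  moreover have "pverts G \<noteq> {}" "connected_in (parcs G) (pverts G)"
    using assms connected_graph_iff by auto
  moreover have "\<not> hole (parcs G) n c" for n c using assms chordal_iff_no_hole by blast
  ultimately obtain c n where "c \<in> pverts G" "\<forall>r \<in> pverts G. cop_wins_within (pverts G) (parcs G) n c r"
    using chordal_cop_wins_within[of "parcs G" "pverts G"] pair_finite_verts by blast
  then show ?thesis using cop_win_if_cop_wins_within[OF assms(1)] by blast
qed

theorem theorem3p9:
  fixes G :: "'a pair_pre_digraph"
  assumes "pair_graph G" and "outerplanar G"
  shows "cop_win G \<longleftrightarrow> connected_graph G \<and> chordal G"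
proof
  assume "cop_win G"
  then show "connected_graph G \<and> chordal G"
    using cop_win_connected[OF assms(1)] chordal_iff_no_hole[OF assms(1)]
      outerplanar_hole_not_cop_win[OF assms] by metis
next
  assume "connected_graph G \<and> chordal G"
  then show "cop_win G"
    using connected_chordal_cop_win[OF assms(1)] by simp
qed

end
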